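(* Let $\mathcal{Q}\subseteq\mathbb{R}^d$ be a finite set of points and $\omega:\mathcal{Q}\to\mathbb{R}$ a weight function, both fixed (not depending on the data or on $N$). For each $N\in\mathbb{N}$ let the random vector $Y\in\mathbb{R}^N$ have distribution $P_N^*$. Suppose the model density of $Y$ is $\pi(y)=\int\pi(y,u)\,du$ for a joint density $\pi(y,u)$, $u\in\mathbb{R}^d$, and define $$\widetilde\pi(y)=\sum_{z\in\mathcal{Q}}\omega(z)\,\pi(y,z).$$ Write $\pi(u\mid y)=\pi(y,u)/\pi(y)$, and denote by $\xrightarrow{p}$ convergence in probability with respect to $P_N^*$ as $N\to\infty$. If there exists $u_*\in\mathbb{R}^d$ such that $\pi(u_*\mid y)\xrightarrow{p}\infty$ and $\pi(u\mid y)\xrightarrow{p}0$ for all $u\ne u_*$, then there exist $\kappa>0$ and $\gamma\in(0,1)$ such that $$\lim_{N\to\infty}P_N^*\left\{\left|\frac{\widetilde\pi(y)}{\pi(y)}-1\right|>\kappa\right\}>\gamma .$$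
   Context: The data vector $y$ inside probability statements is distributed according to $P_N^*$, which need not coincide with the model density $\pi(y)$; the model density (and the joint density $\pi(y,u)$) is specified for each $N$. The notation $\pi(u_*\mid y)\xrightarrow{p}\infty$ means that for every $M>0$, $P_N^*\{\pi(u_*\mid y)>M\}\to1$. A pair $(\mathcal{Q},\omega)$ as in the claim is called a fixed (non-adaptive) quadrature rule. *)

theory Defs
  imports "HOL-Probability.Probability"
begin

text \<open>The points of \<open>\<real>\<^sup>N\<close>, with \<open>N\<close> an ordinary natural number, are the functions on
  \<open>{..<N}\<close> that are extended by \<open>undefined\<close>, as usual for \<^const>\<open>PiM\<close>.\<close>

definition data_space :: "nat \<Rightarrow> (nat \<Rightarrow> real) measure" where
  "data_space N = (\<Pi>\<^sub>M i\<in>{..<N}. borel)"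

definition prob_density :: "'b measure \<Rightarrow> ('b \<Rightarrow> real) \<Rightarrow> bool" where
  "prob_density M f \<longleftrightarrow>
     f \<in> borel_measurable M \<and> (\<forall>x\<in>space M. 0 \<le> f x) \<and> (\<integral>\<^sup>+x. ennreal (f x) \<partial>M) = 1"

text \<open>A joint density of \<open>(y, u)\<close> is taken with respect to \<open>\<nu> \<Otimes> du\<close>, where \<open>\<nu>\<close> is the measure
  on the data space that dominates the model (Lebesgue measure for continuous data, counting
  measure on a countable set for discrete data) and \<open>du\<close> is Lebesgue measure.\<close>

definition joint_density ::
    "nat \<Rightarrow> (nat \<Rightarrow> real) measure \<Rightarrow> ((nat \<Rightarrow> real) \<Rightarrow> real ^ 'd \<Rightarrow> real) \<Rightarrow> bool" where
  "joint_density N \<nu> f \<longleftrightarrow>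
     sigma_finite_measure \<nu> \<and> sets \<nu> = sets (data_space N) \<and>
     prob_density (\<nu> \<Otimes>\<^sub>M lborel) (\<lambda>(y, u). f y u)"

text \<open>The integral below is \<open>0\<close> where it diverges, and division by \<open>0\<close> gives \<open>0\<close>. So \<open>posterior\<close>
  vanishes at a data point with zero or infinite marginal. Under the hypothesis
  \<open>\<pi>(u\<^sub>* | y) \<rightarrow> \<infinity>\<close> in probability the \<open>P\<^sub>N\<^sup>*\<close>-probability of such data points tends
  to \<open>0\<close>, so this convention does not affect any limit.\<close>

definition marginal :: "('b \<Rightarrow> real ^ 'd \<Rightarrow> real) \<Rightarrow> 'b \<Rightarrow> real" where
  "marginal f y = (\<integral>u. f y u \<partial>lborel)"

definition posterior :: "('b \<Rightarrow> real ^ 'd \<Rightarrow> real) \<Rightarrow> real ^ 'd \<Rightarrow> 'b \<Rightarrow> real" where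
  "posterior f u y = f y u / marginal f y"

definition quadrature ::
    "(real ^ 'd) set \<Rightarrow> (real ^ 'd \<Rightarrow> real) \<Rightarrow> ('b \<Rightarrow> real ^ 'd \<Rightarrow> real) \<Rightarrow> 'b \<Rightarrow> real" where
  "quadrature Q \<omega> f y = (\<Sum>z\<in>Q. \<omega> z * f y z)"

text \<open>In the next two definitions the probability measure varies with the index.\<close>

definition tendsto_in_prob ::
    "(nat \<Rightarrow> 'b measure) \<Rightarrow> (nat \<Rightarrow> 'b \<Rightarrow> real) \<Rightarrow> real \<Rightarrow> bool" where
  "tendsto_in_prob P X c \<longleftrightarrow>
     (\<forall>\<epsilon>>0. (\<lambda>N. measure (P N) {y \<in> space (P N). \<bar>X N y - c\<bar> > \<epsilon>}) \<longlonglongrightarrow> 0)"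

definition tendsto_infinity_in_prob ::
    "(nat \<Rightarrow> 'b measure) \<Rightarrow> (nat \<Rightarrow> 'b \<Rightarrow> real) \<Rightarrow> bool" where
  "tendsto_infinity_in_prob P X \<longleftrightarrow>
     (\<forall>M>0. (\<lambda>N. measure (P N) {y \<in> space (P N). X N y > M}) \<longlonglongrightarrow> 1)"

end

theory Submission
  imports Defs
begin

text \<open>The ratio is \<open>\<omega>(u\<^sub>*) \<pi>(u\<^sub>* | y) + \<Sum> \<omega>(z) \<pi>(z | y)\<close>, summed over the points
  \<open>z \<noteq> u\<^sub>*\<close> of \<open>Q\<close>. The sum tends to \<open>0\<close> in probability, so
  the ratio tends to \<open>0\<close> if \<open>u\<^sub>* \<notin> Q\<close> or \<open>\<omega>(u\<^sub>*) = 0\<close>, and is unbounded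
  otherwise. In both cases it stays away from \<open>1\<close> with probability tending to \<open>1\<close>.\<close>

lemma quadrature_div_marginal:
  "quadrature Q \<omega> f y / marginal f y = (\<Sum>z\<in>Q. \<omega> z * posterior f z y)"
  by (simp add: quadrature_def posterior_def sum_divide_distrib)

text \<open>Measurability depends only on the sigma-algebra. The density is given with respect to
  the dominating measure \<open>\<nu>\<close>, while probabilities are taken under the data law
  \<open>P\<close>; the two share their measurable sets, so measurability carries over.\<close>

lemma joint_density_measurable:
  assumes "joint_density N \<nu> f" "sets P = sets (data_space N)"
  shows "(\<lambda>(y, u). f y u) \<in> borel_measurable (P \<Otimes>\<^sub>M lborel)"
proof -
  have "sets (P \<Otimes>\<^sub>M lborel) = sets (\<nu> \<Otimes>\<^sub>M lborel)"
    using assms by (intro sets_pair_measure_cong) (auto simp: joint_density_def)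
  moreover have "(\<lambda>(y, u). f y u) \<in> borel_measurable (\<nu> \<Otimes>\<^sub>M lborel)"
    using assms(1) unfolding joint_density_def prob_density_def by blast
  ultimately show ?thesis
    using measurable_cong_sets by blast
qed

lemma borel_measurable_posterior:
  assumes "joint_density N \<nu> f" "sets P = sets (data_space N)"
  shows "posterior f u \<in> borel_measurable P"
proof -
  note [measurable] = joint_density_measurable[OF assms]
  have [measurable]: "(\<lambda>y. f y u) \<in> borel_measurable P"
    using measurable_compose[OF measurable_Pair2'[of u lborel P] joint_density_measurable[OF assms]]
    by simp
  have [measurable]: "marginal f \<in> borel_measurable P"
    unfolding marginal_def
    by (rule sigma_finite_measure.borel_measurable_lebesgue_integral[OF sigma_finite_lborel]) measurable
  show ?thesis
    unfolding posterior_def by measurable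
qed

text \<open>The deterministic core, applied to \<open>g z = \<pi>(z | y)\<close> at a fixed data
  point. The points other than \<open>a\<close> contribute at most 1/3 in absolute value, whatever
  the signs of the weights. The point \<open>a\<close> contributes either 0 or at least 3 in
  absolute value, so the sum has distance at least 2/3 or at least 5/3 from 1.\<close>

lemma weighted_sum_away_from_1:
  fixes \<omega> g :: "'a \<Rightarrow> real"
  assumes "finite Q"
    and large: "3 / \<bar>\<omega> a\<bar> + 1 < g a"
    and small: "\<And>z. z \<in> Q - {a} \<Longrightarrow> \<bar>g z\<bar> \<le> 1 / (3 * (1 + (\<Sum>z\<in>Q. \<bar>\<omega> z\<bar>)))"
  shows "\<bar>(\<Sum>z\<in>Q. \<omega> z * g z) - 1\<bar> > 1 / 2"
proof -
  define W where "W = (\<Sum>z\<in>Q. \<bar>\<omega> z\<bar>)"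
  have W: "W \<ge> 0" by (simp add: W_def sum_nonneg)
  define R where "R = (\<Sum>z\<in>Q - {a}. \<omega> z * g z)"
  have "\<bar>R\<bar> \<le> (\<Sum>z\<in>Q - {a}. \<bar>\<omega> z\<bar> * (1 / (3 * (1 + W))))"
    unfolding R_def
    by (rule sum_abs[THEN order_trans], rule sum_mono, unfold abs_mult W_def)
       (intro mult_left_mono small, auto)
  also have "\<dots> \<le> W * (1 / (3 * (1 + W)))"
    unfolding W_def sum_distrib_right[symmetric] using \<open>finite Q\<close> W[unfolded W_def]
    by (intro mult_right_mono sum_mono2) auto
  also have "\<dots> \<le> 1 / 3"
    using W by (simp add: divide_simps)
  finally have R: "\<bar>R\<bar> \<le> 1 / 3" .
  show ?thesis
  proof (cases "a \<in> Q \<and> \<omega> a \<noteq> 0")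
    case True
    have "(\<Sum>z\<in>Q. \<omega> z * g z) = \<omega> a * g a + R"
      unfolding R_def using True \<open>finite Q\<close> by (intro sum.remove) auto
    moreover have "\<bar>\<omega> a * g a\<bar> \<ge> 3"
    proof -
      have "3 = \<bar>\<omega> a\<bar> * (3 / \<bar>\<omega> a\<bar>)"
        using True by simp
      also have "\<dots> \<le> \<bar>\<omega> a\<bar> * \<bar>g a\<bar>"
        using large by (intro mult_left_mono) auto
      finally show ?thesis by (simp add: abs_mult)
    qed
    ultimately show ?thesis using R by linarith
  next
    case False
    \<comment> \<open>If \<open>a\<close> lies outside \<open>Q\<close>, then \<open>Q - {a}\<close>
      is \<open>Q\<close> itself; otherwise \<open>\<omega> a = 0\<close> and its summand
      vanishes.\<close>
    then have "(\<Sum>z\<in>Q. \<omega> z * g z) = R"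
      unfolding R_def using \<open>finite Q\<close> by (cases "a \<in> Q") (auto simp: sum.remove)
    then show ?thesis using R by linarith
  qed
qed

text \<open>By the union bound, \<open>T N\<close> has probability at least that of
  \<open>A N\<close> minus the sum of those of the sets \<open>B i N\<close>. This lower bound tends
  to 1 because the sum has finitely many terms. The hypotheses are eventual because the theorem
  constrains the laws only from index 1 on.\<close>

lemma measure_tendsto_1_if_subset:
  assumes "finite I"
    and prob: "\<forall>\<^sub>F N in sequentially. prob_space (P N)"
    and sets: "\<forall>\<^sub>F N in sequentially.
      A N \<in> sets (P N) \<and> T N \<in> sets (P N) \<and> (\<forall>i\<in>I. B i N \<in> sets (P N))"
    and sub: "\<forall>\<^sub>F N in sequentially. A N \<subseteq> T N \<union> (\<Union>i\<in>I. B i N)"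
    and A: "(\<lambda>N. measure (P N) (A N)) \<longlonglongrightarrow> 1"
    and B: "\<And>i. i \<in> I \<Longrightarrow> (\<lambda>N. measure (P N) (B i N)) \<longlonglongrightarrow> 0"
  shows "(\<lambda>N. measure (P N) (T N)) \<longlonglongrightarrow> 1"
proof (rule tendsto_sandwich)
  show "\<forall>\<^sub>F N in sequentially.
      measure (P N) (A N) - (\<Sum>i\<in>I. measure (P N) (B i N)) \<le> measure (P N) (T N)"
    using prob sets sub
  proof eventually_elim
    case (elim N)
    interpret prob_space "P N" by (fact elim(1))
    have "measure (P N) (A N) \<le> measure (P N) (T N \<union> (\<Union>i\<in>I. B i N))"
      using elim \<open>finite I\<close> by (intro finite_measure_mono) auto
    also have "\<dots> \<le> measure (P N) (T N) + measure (P N) (\<Union>i\<in>I. B i N)"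
      using elim \<open>finite I\<close> by (intro measure_Un_le) auto
    also have "measure (P N) (\<Union>i\<in>I. B i N) \<le> (\<Sum>i\<in>I. measure (P N) (B i N))"
      using elim \<open>finite I\<close> by (intro measure_UNION_le) auto
    finally show ?case by simp
  qed
  show "\<forall>\<^sub>F N in sequentially. measure (P N) (T N) \<le> 1"
    using prob by eventually_elim (rule prob_space.prob_le_1)
  have "(\<lambda>N. measure (P N) (A N) - (\<Sum>i\<in>I. measure (P N) (B i N))) \<longlonglongrightarrow> 1 - (\<Sum>i\<in>I. 0)"
    by (intro tendsto_diff A tendsto_sum B)
  then show "(\<lambda>N. measure (P N) (A N) - (\<Sum>i\<in>I. measure (P N) (B i N))) \<longlonglongrightarrow> 1"
    by simp
qed simp

theorem theorem1:
  fixes Q :: "(real ^ 'd) set" and \<omega> :: "real ^ 'd \<Rightarrow> real"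
    and P \<nu> :: "nat \<Rightarrow> (nat \<Rightarrow> real) measure"
    and f :: "nat \<Rightarrow> (nat \<Rightarrow> real) \<Rightarrow> real ^ 'd \<Rightarrow> real"
  assumes "finite Q"
    and "\<And>N. N \<ge> 1 \<Longrightarrow> prob_space (P N)"
    and "\<And>N. N \<ge> 1 \<Longrightarrow> sets (P N) = sets (data_space N)"
    and "\<And>N. N \<ge> 1 \<Longrightarrow> joint_density N (\<nu> N) (f N)"
    and "\<exists>u_star. tendsto_infinity_in_prob P (\<lambda>N. posterior (f N) u_star) \<and>
           (\<forall>u. u \<noteq> u_star \<longrightarrow> tendsto_in_prob P (\<lambda>N. posterior (f N) u) 0)"
  shows "\<exists>\<kappa>>0. \<exists>\<gamma>\<in>{0<..<1}. \<exists>L.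
           (\<lambda>N. measure (P N)
              {y \<in> space (P N). \<bar>quadrature Q \<omega> (f N) y / marginal (f N) y - 1\<bar> > \<kappa>})
             \<longlonglongrightarrow> L \<and> L > \<gamma>"
proof -
  from assms(5) obtain a where
    inf: "tendsto_infinity_in_prob P (\<lambda>N. posterior (f N) a)" and
    zero: "\<And>u. u \<noteq> a \<Longrightarrow> tendsto_in_prob P (\<lambda>N. posterior (f N) u) 0"
    by blast
  \<comment> \<open>The summand \<open>1\<close> in \<open>M\<close> keeps it positive when \<open>\<omega> a = 0\<close>, where \<open>3 / \<bar>\<omega> a\<bar> = 0\<close>.\<close>
  define M where "M = 3 / \<bar>\<omega> a\<bar> + 1"
  \<comment> \<open>Chosen so that \<open>\<epsilon>\<close> times the total absolute weight is at
    most 1/3. The summand 1 avoids a zero denominator when all weights vanish.\<close>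
  define \<epsilon> where "\<epsilon> = 1 / (3 * (1 + (\<Sum>z\<in>Q. \<bar>\<omega> z\<bar>)))"
  define T where "T N = {y \<in> space (P N).
    \<bar>quadrature Q \<omega> (f N) y / marginal (f N) y - 1\<bar> > 1 / 2}" for N
  define A where "A N = {y \<in> space (P N). posterior (f N) a y > M}" for N
  \<comment> \<open>The term \<open>- 0\<close> matches the unfolded form of
    \<open>tendsto_in_prob\<close> with limit 0.\<close>
  define B where "B z N = {y \<in> space (P N). \<bar>posterior (f N) z y - 0\<bar> > \<epsilon>}" for z N
  have "M > 0"
    unfolding M_def by (intro add_nonneg_pos) auto
  have "1 + (\<Sum>z\<in>Q. \<bar>\<omega> z\<bar>) > 0"
    by (intro add_pos_nonneg sum_nonneg) auto
  then have "\<epsilon> > 0"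
    by (simp add: \<epsilon>_def)
  have "(\<lambda>N. measure (P N) (T N)) \<longlonglongrightarrow> 1"
  proof (rule measure_tendsto_1_if_subset[where I = "Q - {a}" and A = A and B = B])
    show "finite (Q - {a})"
      using \<open>finite Q\<close> by simp
    show "\<forall>\<^sub>F N in sequentially. prob_space (P N)"
      using eventually_ge_at_top[of 1] by eventually_elim (rule assms(2))
    show "\<forall>\<^sub>F N in sequentially.
        A N \<in> sets (P N) \<and> T N \<in> sets (P N) \<and> (\<forall>z\<in>Q - {a}. B z N \<in> sets (P N))"
      using eventually_ge_at_top[of 1]
    proof eventually_elim
      case (elim N)
      have [measurable]: "posterior (f N) u \<in> borel_measurable (P N)" for u
        using assms(3,4)[OF elim] by (intro borel_measurable_posterior)
      show ?case
        unfolding A_def T_def B_def quadrature_div_marginal by measurable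
    qed
    show "\<forall>\<^sub>F N in sequentially. A N \<subseteq> T N \<union> (\<Union>z\<in>Q - {a}. B z N)"
    \<comment> \<open>The inclusion is pointwise in the data: if the posterior exceeds
      \<open>M\<close> at \<open>a\<close> and stays within \<open>\<epsilon>\<close> of 0 at the
      other nodes, the deterministic bound applies.\<close>
    proof (intro always_eventually allI subsetI)
      fix N y
      assume y: "y \<in> A N"
      show "y \<in> T N \<union> (\<Union>z\<in>Q - {a}. B z N)"
      proof (cases "\<exists>z\<in>Q - {a}. y \<in> B z N")
        case False
        then have "\<bar>(\<Sum>z\<in>Q. \<omega> z * posterior (f N) z y) - 1\<bar> > 1 / 2"
          using y \<open>finite Q\<close>
          by (intro weighted_sum_away_from_1[of Q \<omega> a])
             (auto simp: A_def B_def M_def \<epsilon>_def not_less)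
        then show ?thesis
          using y by (simp add: A_def T_def quadrature_div_marginal)
      qed blast
    qed
    show "(\<lambda>N. measure (P N) (A N)) \<longlonglongrightarrow> 1"
      using inf \<open>M > 0\<close> unfolding tendsto_infinity_in_prob_def A_def by blast
    show "(\<lambda>N. measure (P N) (B z N)) \<longlonglongrightarrow> 0" if "z \<in> Q - {a}" for z
      using zero[of z] that \<open>\<epsilon> > 0\<close> unfolding tendsto_in_prob_def B_def by blast
  qed
  then show ?thesis
    unfolding T_def
    \<comment> \<open>The first 1/2 is \<open>\<kappa>\<close>, the threshold in \<open>T\<close>.
      The second is \<open>\<gamma>\<close>; as the limit is 1, any value in (0,1) would
      serve.\<close>
    by (intro exI[of _ "1 / 2 :: real"] bexI[of _ "1 / 2 :: real"] conjI exI[of _ "1 :: real"]) auto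
qed

end
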